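(* Fix non-zero integers $r$ and $s$, and let $a_{k,n}$ denote the entries of the binomial array $B(sx+r)$. Then for every integer $n>0$, $$\sum_{i=0}^{n+1}a_{i,n}a_{n+1-i,n}=\big[(r+s)^2n+2rs\big]C_n$$ and $$\sum_{i=0}^{n+2}a_{i,n}a_{n+2-i,n+1}=\tfrac12\big[(r+s)^2n+4rs+2s^2\big]C_{n+1},$$ where $C_n=\frac{1}{n+1}\binom{2n}{n}$ is the $n$-th Catalan number.
   Context: The binomial array $B(p(x))$ of a power series $p(x)$ has entries $a_{k,n}$ ($k\ge0$, $n\in\mathbb{Z}$) equal to the coefficient of $x^k$ in $(1+x)^np(x)$; here $p(x)=r+sx$, so $a_{k,n}=r\binom{n}{k}+s\binom{n}{k-1}$ for $n\ge0$. *)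

theory Defs
  imports Complex_Main "HOL-Computational_Algebra.Formal_Power_Series"
begin

(* Coefficients are taken in the rationals so that the library's integer power powi, which
   relies on inverse, is available on power series.  The constant term of 1 + fps_X is 1, so
   for negative n this is a power of its genuine multiplicative inverse. *)
definition binomial_array :: "rat fps \<Rightarrow> nat \<Rightarrow> int \<Rightarrow> rat" where
  "binomial_array p k n = fps_nth ((1 + fps_X) powi n * p) k"

definition catalan :: "nat \<Rightarrow> rat" where
  "catalan n = 1 / (of_nat n + 1) * of_nat ((2 * n) choose n)"

end

theory Submission
  imports Defs
begin

text \<open>The convolution of columns \<open>m\<close> and \<open>l\<close> of the array is a coefficient of
  \<open>(1 + x)^(m + l) * (r + s x)\<^sup>2\<close>, that is, a combination of three consecutive binomial
  coefficients, which for the columns in question lie next to the middle of row \<open>2n\<close>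
  or \<open>2n + 1\<close> and hence are simple multiples of a Catalan number.\<close>

lemma fps_nth_one_plus_X_power:
  "fps_nth ((1 + fps_X :: 'a::field_char_0 fps) ^ n) k = of_nat (n choose k)"
  by (simp add: binomial_gbinomial flip: fps_binomial_of_nat)

text \<open>Columns with non-negative index have ordinary powers of \<open>1 + fps_X\<close> as
  factors, so the sum is a Cauchy product in which these powers merge.\<close>

lemma binomial_array_convolution:
  "(\<Sum>i=0..k. binomial_array p i (int m) * binomial_array q (k - i) (int l))
     = fps_nth ((1 + fps_X) ^ (m + l) * (p * q)) k"
proof -
  have "(\<Sum>i=0..k. binomial_array p i (int m) * binomial_array q (k - i) (int l))
     = fps_nth (((1 + fps_X) ^ m * p) * ((1 + fps_X) ^ l * q)) k"
    by (simp only: fps_mult_nth binomial_array_def power_int_of_nat)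
  then show ?thesis
    by (simp only: power_add mult_ac)
qed

text \<open>Indexing by \<open>k + 2\<close> keeps the shifts by \<open>fps_X\<close> and its square
  from reaching below index 0, so no case distinction arises.\<close>

lemma binomial_array_linear_convolution:
  fixes r s :: rat
  defines "p \<equiv> fps_const s * fps_X + fps_const r"
  shows "(\<Sum>i=0..k+2. binomial_array p i (int m) * binomial_array p (k + 2 - i) (int l))
     = r^2 * of_nat ((m + l) choose (k + 2)) + 2 * r * s * of_nat ((m + l) choose (k + 1))
       + s^2 * of_nat ((m + l) choose k)"
proof -
  \<comment> \<open>Writing \<open>fps_X ^ 1\<close> lets one shift rule for powers of
    \<open>fps_X\<close> read off both shifted terms.\<close>
  have "(1 + fps_X) ^ (m + l) * (p * p)
      = fps_const (r^2) * (1 + fps_X) ^ (m + l)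
        + fps_const (2 * r * s) * (fps_X ^ 1 * (1 + fps_X) ^ (m + l))
        + fps_const (s^2) * (fps_X ^ 2 * (1 + fps_X) ^ (m + l))"
    unfolding p_def
    by (simp add: power2_eq_square fps_numeral_fps_const algebra_simps flip: fps_const_mult mult_2)
  then show ?thesis
    unfolding binomial_array_convolution
    by (simp only: fps_add_nth fps_mult_left_const_nth fps_X_power_mult_nth
        fps_nth_one_plus_X_power) simp
qed

lemma central_binomial_catalan:
  "of_nat ((2 * n) choose n) = (of_nat n + 1) * catalan n"
proof -
  have "(of_nat n + 1 :: rat) \<noteq> 0"
    by (metis of_nat_Suc of_nat_eq_0_iff add.commute nat.distinct(1))
  then show ?thesis
    by (simp add: catalan_def)
qed

text \<open>Both sides equal \<open>n\<close> times \<open>(n - 1) gchoose k\<close>. The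
  subtraction takes place in the field, so the case \<open>k > n\<close> is covered too.\<close>

lemma binomial_Suc_absorb:
  "(of_nat k + 1) * of_nat (n choose (k + 1))
     = (of_nat n - of_nat k) * (of_nat (n choose k) :: 'a::field_char_0)"
  using gbinomial_absorption[of k "of_nat n :: 'a"] gbinomial_absorb_comp[of "of_nat n :: 'a" k]
  by (simp add: binomial_gbinomial add.commute)

lemma binomial_even_next_catalan:
  "of_nat ((2 * n) choose (n + 1)) = of_nat n * catalan n"
proof -
  have "(of_nat n + 1 :: rat) \<noteq> 0"
    by (metis of_nat_Suc of_nat_eq_0_iff add.commute nat.distinct(1))
  moreover have "(of_nat n + 1) * of_nat ((2 * n) choose (n + 1))
      = (of_nat n + 1) * (of_nat n * catalan n)"
    using binomial_Suc_absorb[of n "2 * n", where 'a = rat]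
    by (simp add: central_binomial_catalan)
  ultimately show ?thesis by simp
qed

text \<open>Pascal's rule splits the central entry of row \<open>2 * n + 2\<close> into the two
  middle entries of row \<open>2 * n + 1\<close>, which are equal by symmetry; each is thus half of
  it.\<close>

lemma binomial_odd_middle_catalan:
  "of_nat ((2 * n + 1) choose n) = (of_nat n + 2) / 2 * catalan (n + 1)"
proof -
  have "(2 * (n + 1)) choose (n + 1) = ((2 * n + 1) choose n) + ((2 * n + 1) choose (n + 1))"
    by simp
  moreover have "(2 * n + 1) choose (n + 1) = (2 * n + 1) choose n"
    using binomial_symmetric[of n "2 * n + 1"] by simp
  ultimately have "2 * of_nat ((2 * n + 1) choose n) = (of_nat n + 2) * catalan (n + 1)"
    using central_binomial_catalan[of "n + 1"] by (simp add: add.commute)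
  then show ?thesis by simp
qed

lemma binomial_odd_next_catalan:
  "of_nat ((2 * n + 1) choose (n + 2)) = of_nat n / 2 * catalan (n + 1)"
proof -
  have "of_nat ((2 * n + 1) choose (n + 1)) = (of_nat n + 2) / 2 * catalan (n + 1)"
    using binomial_symmetric[of n "2 * n + 1"] binomial_odd_middle_catalan[of n] by simp
  \<comment> \<open>Absorption at \<open>k = n + 1\<close>: the factor \<open>n\<close> is
    \<open>(2 * n + 1) - (n + 1)\<close>.\<close>
  moreover have "(of_nat n + 2) * of_nat ((2 * n + 1) choose (n + 2))
      = of_nat n * (of_nat ((2 * n + 1) choose (n + 1)) :: rat)"
    using binomial_Suc_absorb[of "n + 1" "2 * n + 1", where 'a = rat]
    by (simp add: add.commute del: binomial_Suc_Suc)
  ultimately have "(of_nat n + 2) * of_nat ((2 * n + 1) choose (n + 2))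
      = (of_nat n + 2) * (of_nat n / 2 * catalan (n + 1))"
    by (simp only:) simp
  moreover have "(of_nat n + 2 :: rat) \<noteq> 0"
    by (metis of_nat_add of_nat_numeral of_nat_eq_0_iff add_is_0 zero_neq_numeral)
  ultimately show ?thesis by (simp only: mult_cancel_left) simp
qed

theorem theorem7p3:
  fixes r s :: int and a :: "nat \<Rightarrow> int \<Rightarrow> rat" and n :: nat
  assumes "r \<noteq> 0" and "s \<noteq> 0"
    and "a = binomial_array (fps_const (of_int s) * fps_X + fps_const (of_int r))"
    and "n > 0"
  shows "(\<Sum>i=0..n+1. a i (int n) * a (n + 1 - i) (int n))
           = ((of_int r + of_int s)^2 * of_nat n + 2 * of_int r * of_int s) * catalan n
       \<and> (\<Sum>i=0..n+2. a i (int n) * a (n + 2 - i) (int n + 1))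
           = 1/2 * ((of_int r + of_int s)^2 * of_nat n + 4 * of_int r * of_int s + 2 * (of_int s)^2)
               * catalan (n + 1)"
proof
  let ?r = "of_int r :: rat" and ?s = "of_int s :: rat"
  \<comment> \<open>The convolution lemma is used with \<open>k = n - 1\<close>; positivity of
    \<open>n\<close> makes this subtraction exact.\<close>
  have n: "n - 1 + 2 = n + 1" "n - 1 + 1 = n"
    using \<open>n > 0\<close> by simp_all
  \<comment> \<open>The three entries are centred in row \<open>2 * n\<close>, so \<open>r^2\<close>
    and \<open>s^2\<close> get the same coefficient.\<close>
  have "(2 * n) choose (n - 1) = (2 * n) choose (n + 1)"
    using binomial_symmetric[of "n - 1" "2 * n"] \<open>n > 0\<close> by (simp add: Suc_diff_le)
  then have "(\<Sum>i=0..n+1. a i (int n) * a (n + 1 - i) (int n))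
      = ?r^2 * (of_nat n * catalan n) + 2 * ?r * ?s * ((of_nat n + 1) * catalan n)
        + ?s^2 * (of_nat n * catalan n)"
    using binomial_array_linear_convolution[where r = ?r and s = ?s and k = "n - 1" and m = n and l = n]
    unfolding n assms(3)
    by (simp only: mult_2[symmetric] binomial_even_next_catalan central_binomial_catalan)
  then show "(\<Sum>i=0..n+1. a i (int n) * a (n + 1 - i) (int n))
      = ((?r + ?s)^2 * of_nat n + 2 * ?r * ?s) * catalan n"
    by (simp add: power2_eq_square algebra_simps)
  \<comment> \<open>Here the window is off-centre: the two middle entries go with
    \<open>2 * r * s\<close> and \<open>s^2\<close>, the outer one with \<open>r^2\<close>. This is
    the source of the extra \<open>2 * s^2\<close>.\<close>
  have "(2 * n + 1) choose (n + 1) = (2 * n + 1) choose n"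
    using binomial_symmetric[of n "2 * n + 1"] by simp
  moreover have "n + (n + 1) = 2 * n + 1" "int n + 1 = int (n + 1)"
    by simp_all
  ultimately have "(\<Sum>i=0..n+2. a i (int n) * a (n + 2 - i) (int n + 1))
      = ?r^2 * (of_nat n / 2 * catalan (n + 1))
        + 2 * ?r * ?s * ((of_nat n + 2) / 2 * catalan (n + 1))
        + ?s^2 * ((of_nat n + 2) / 2 * catalan (n + 1))"
    using binomial_array_linear_convolution[where r = ?r and s = ?s and k = n and m = n and l = "n + 1"]
    unfolding assms(3)
    by (simp only: binomial_odd_next_catalan binomial_odd_middle_catalan)
  then show "(\<Sum>i=0..n+2. a i (int n) * a (n + 2 - i) (int n + 1))
      = 1/2 * ((?r + ?s)^2 * of_nat n + 4 * ?r * ?s + 2 * ?s^2) * catalan (n + 1)"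
    by (simp add: power2_eq_square field_simps)
qed

end
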